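(* Let $(X,d)$ be a Hadamard space and let $m$ be a positive integer. If $S_i : X \to X$ is a strongly quasi-nonexpansive $\Delta$-demiclosed mapping for all $i \in \{1,2,\dots,m\}$ and $\bigcap_{i=1}^m Fix(S_i) \neq \emptyset$, then $S = S_m S_{m-1} \cdots S_1$ is a strongly quasi-nonexpansive orbital $\Delta$-demiclosed mapping.
   Context: A Hadamard space is a complete $\mathrm{CAT}(0)$ space. Products of mappings denote composition: $S_m S_{m-1}\cdots S_1 = S_m\circ S_{m-1}\circ\cdots\circ S_1$, and $S^n$ is the $n$-th iterate of $S$. For a bounded sequence $\{x_n\}$ in $X$, the asymptotic center is $\mathcal{A}(\{x_n\}) = \{ z \in X : \limsup_{n} d(z,x_n) = \inf_{y \in X} \limsup_{n} d(y,x_n)\}$ (a singleton in a Hadamard space). A bounded sequence $\{x_n\}$ is $\Delta$-convergent to $z \in X$ (written $x_n \xrightarrow{\Delta} z$; $z$ is the $\Delta$-limit) if $\mathcal{A}(\{x_{n_i}\}) = \{z\}$ for each subsequence $\{x_{n_i}\}$ of $\{x_n\}$. For $S : X \to X$, $Fix(S) = \{x \in X : S(x) = x\}$. $S$ is quasi-nonexpansive if $Fix(S) \neq \emptyset$ and $d(S(x),q) \le d(x,q)$ for all $x \in X$ and $q \in Fix(S)$. $S$ is strongly quasi-nonexpansive if $S$ is quasi-nonexpansive and $\lim_{n\to\infty} d(x_n, S(x_n)) = 0$ whenever $\{x_n\}$ is a bounded sequence in $X$ such that $\lim_{n\to\infty}[d(x_n,q) - d(S(x_n),q)] = 0$ for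 some $q \in Fix(S)$. $S$ is $\Delta$-demiclosed if for any $\Delta$-convergent sequence $\{x_n\}$ in $X$, its $\Delta$-limit belongs to $Fix(S)$ whenever $\lim_{n\to\infty} d(x_n,S(x_n)) = 0$. $S$ is orbital $\Delta$-demiclosed if $x^\ast \in Fix(S)$ whenever $\{x_k\}$ is a sequence in $X$ satisfying: (1) $x_k \xrightarrow{\Delta} x^\ast$; (2) $d(S(x_k),x_k) \to 0$; and (3) $\{x_k\}$ is a subsequence of $\{S^n(\hat{x})\}$ for some $\hat{x} \in X$. *)

theory Defs
  imports "HOL-Analysis.Analysis"
begin

definition geodesic_segment :: "'a::metric_space \<Rightarrow> 'a \<Rightarrow> 'a set \<Rightarrow> bool" where
  "geodesic_segment x y A \<longleftrightarrow>
     (\<exists>c :: real \<Rightarrow> 'a. c 0 = x \<and> c (dist x y) = y \<and>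
        (\<forall>s\<in>{0..dist x y}. \<forall>t\<in>{0..dist x y}. dist (c s) (c t) = \<bar>s - t\<bar>) \<and>
        A = c ` {0..dist x y})"

definition comparison_triangle ::
    "'a::metric_space \<Rightarrow> 'a \<Rightarrow> 'a \<Rightarrow> real^2 \<Rightarrow> real^2 \<Rightarrow> real^2 \<Rightarrow> bool" where
  "comparison_triangle x y z x' y' z' \<longleftrightarrow>
     dist x' y' = dist x y \<and> dist y' z' = dist y z \<and> dist z' x' = dist z x"

text \<open>
  The point \<open>p'\<close> of the Euclidean segment from \<open>x'\<close> to \<open>y'\<close> is a comparison point for the point \<open>p\<close>
  of the geodesic segment \<open>A\<close>, which starts at \<open>x\<close>.
\<close>

definition comparison_point ::
    "'a::metric_space \<Rightarrow> 'a set \<Rightarrow> real^2 \<Rightarrow> real^2 \<Rightarrow> 'a \<Rightarrow> real^2 \<Rightarrow> bool" where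
  "comparison_point x A x' y' p p' \<longleftrightarrow>
     p \<in> A \<and> p' \<in> closed_segment x' y' \<and> dist x' p' = dist x p"

definition comparison_point_triangle ::
    "'a::metric_space \<Rightarrow> 'a \<Rightarrow> 'a \<Rightarrow> 'a set \<Rightarrow> 'a set \<Rightarrow> 'a set \<Rightarrow>
     real^2 \<Rightarrow> real^2 \<Rightarrow> real^2 \<Rightarrow> 'a \<Rightarrow> real^2 \<Rightarrow> bool" where
  "comparison_point_triangle x y z A B C x' y' z' p p' \<longleftrightarrow>
     comparison_point x A x' y' p p' \<or>
     comparison_point y B y' z' p p' \<or>
     comparison_point z C z' x' p p'"

class cat0_space = metric_space +
  assumes geodesic_segment_exists: "\<exists>A. geodesic_segment x y A"
    and cat0_inequality:
      "\<lbrakk>geodesic_segment x y A; geodesic_segment y z B; geodesic_segment z x C;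
        comparison_triangle x y z x' y' z';
        comparison_point_triangle x y z A B C x' y' z' p p';
        comparison_point_triangle x y z A B C x' y' z' q q'\<rbrakk>
       \<Longrightarrow> dist p q \<le> dist p' q'"

class hadamard_space = cat0_space + complete_space

text \<open>
  The upper limits and the infimum are taken in the extended reals; for a bounded sequence
  they are all finite and agree with the real ones.
\<close>

definition asymptotic_center :: "(nat \<Rightarrow> 'a::metric_space) \<Rightarrow> 'a set" where
  "asymptotic_center x =
     {z. limsup (\<lambda>n. ereal (dist z (x n))) = (INF y. limsup (\<lambda>n. ereal (dist y (x n))))}"

definition Delta_convergent_to :: "(nat \<Rightarrow> 'a::metric_space) \<Rightarrow> 'a \<Rightarrow> bool" where
  "Delta_convergent_to x z \<longleftrightarrow>
     bounded (range x) \<and> (\<forall>r. strict_mono r \<longrightarrow> asymptotic_center (x \<circ> r) = {z})"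

definition Fix :: "('a \<Rightarrow> 'a) \<Rightarrow> 'a set" where
  "Fix S = {x. S x = x}"

definition quasi_nonexpansive :: "('a::metric_space \<Rightarrow> 'a) \<Rightarrow> bool" where
  "quasi_nonexpansive S \<longleftrightarrow>
     Fix S \<noteq> {} \<and> (\<forall>x. \<forall>q\<in>Fix S. dist (S x) q \<le> dist x q)"

definition strongly_quasi_nonexpansive :: "('a::metric_space \<Rightarrow> 'a) \<Rightarrow> bool" where
  "strongly_quasi_nonexpansive S \<longleftrightarrow>
     quasi_nonexpansive S \<and>
     (\<forall>x. bounded (range x) \<and>
          (\<exists>q\<in>Fix S. (\<lambda>n. dist (x n) q - dist (S (x n)) q) \<longlonglongrightarrow> 0) \<longrightarrow>
        (\<lambda>n. dist (x n) (S (x n))) \<longlonglongrightarrow> 0)"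

definition Delta_demiclosed :: "('a::metric_space \<Rightarrow> 'a) \<Rightarrow> bool" where
  "Delta_demiclosed S \<longleftrightarrow>
     (\<forall>x z. Delta_convergent_to x z \<and> (\<lambda>n. dist (x n) (S (x n))) \<longlonglongrightarrow> 0 \<longrightarrow> z \<in> Fix S)"

definition orbital_Delta_demiclosed :: "('a::metric_space \<Rightarrow> 'a) \<Rightarrow> bool" where
  "orbital_Delta_demiclosed S \<longleftrightarrow>
     (\<forall>x z. Delta_convergent_to x z \<and>
            (\<lambda>k. dist (S (x k)) (x k)) \<longlonglongrightarrow> 0 \<and>
            (\<exists>w r. strict_mono r \<and> x = (\<lambda>n. (S ^^ n) w) \<circ> r) \<longrightarrow>
        z \<in> Fix S)"

primrec composition_upto :: "(nat \<Rightarrow> 'a \<Rightarrow> 'a) \<Rightarrow> nat \<Rightarrow> 'a \<Rightarrow> 'a" where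
  "composition_upto S 0 = id"
| "composition_upto S (Suc m) = S (Suc m) \<circ> composition_upto S m"

end

theory Submission
  imports Defs
begin

text \<open>
  The composition \<open>T \<circ> S\<close> of two strongly quasi-nonexpansive mappings with a common fixed point
  \<open>p\<close> is handled by one squeeze. Since distances to \<open>p\<close> do not increase along
  \<open>x, S x, T (S x)\<close>, the loss at each of the two steps is at most the total loss
  \<open>dist x p - dist (T (S x)) p\<close>. So if the total loss vanishes along a bounded sequence, both
  partial losses vanish, and the strong property of \<open>S\<close> and of \<open>T\<close> gives that \<open>x\<close>, \<open>S x\<close> and
  \<open>T (S x)\<close> are asymptotically equal (\<open>asymptotic_steps_compose\<close>). Everything follows from this.

  \<^item> For a constant sequence at a fixed point of \<open>T \<circ> S\<close> it says that the point is fixed by both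
    mappings, so \<open>T \<circ> S\<close> has exactly the common fixed points (\<open>Fix_compose\<close>).
  \<^item> Hence every fixed point of \<open>T \<circ> S\<close> may serve as \<open>p\<close>, which is strong quasi-nonexpansiveness
    of \<open>T \<circ> S\<close>.
  \<^item> If \<open>dist (x n) (T (S (x n))) \<longlonglongrightarrow> 0\<close>, the triangle inequality bounds the total loss by this
    distance. So \<open>S\<close> moves \<open>x n\<close>, and \<open>T\<close> moves \<open>S (x n)\<close>, by vanishing amounts. A vanishing
    perturbation does not change \<open>\<Delta>\<close>-limits (\<open>Delta_convergent_to_perturb\<close>), so demiclosedness of
    \<open>S\<close> and of \<open>T\<close> puts the \<open>\<Delta>\<close>-limit of \<open>x\<close> into both fixed point sets.

  Induction on the number of factors, starting with the identity, shows that the whole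
  composition is strongly quasi-nonexpansive and \<open>\<Delta>\<close>-demiclosed; the orbital property is the
  restriction of demiclosedness to subsequences of orbits.
\<close>

lemma limsup_dist_perturb_le:
  fixes x y :: "nat \<Rightarrow> 'a::metric_space"
  assumes "(\<lambda>n. dist (x n) (y n)) \<longlonglongrightarrow> 0"
  shows "limsup (\<lambda>n. ereal (dist u (y n))) \<le> limsup (\<lambda>n. ereal (dist u (x n)))"
proof -
  have "limsup (\<lambda>n. ereal (dist u (y n)))
      \<le> limsup (\<lambda>n. ereal (dist (x n) (y n)) + ereal (dist u (x n)))"
    by (intro Limsup_mono always_eventually allI)
       (simp add: dist_triangle add.commute)
  also have "\<dots> = ereal 0 + limsup (\<lambda>n. ereal (dist u (x n)))"
    by (intro ereal_limsup_lim_add tendsto_ereal assms) simp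
  finally show ?thesis
    by (simp flip: zero_ereal_def)
qed

text \<open>
  The asymptotic center depends only on the functions \<open>u \<mapsto> limsup (dist u (x n))\<close>, and these do
  not see a perturbation that tends to zero.
\<close>

lemma asymptotic_center_perturb:
  fixes x y :: "nat \<Rightarrow> 'a::metric_space"
  assumes "(\<lambda>n. dist (x n) (y n)) \<longlonglongrightarrow> 0"
  shows "asymptotic_center y = asymptotic_center x"
proof -
  have "(\<lambda>n. dist (y n) (x n)) \<longlonglongrightarrow> 0"
    using assms by (simp add: dist_commute)
  then have "limsup (\<lambda>n. ereal (dist u (y n))) = limsup (\<lambda>n. ereal (dist u (x n)))" for u
    using assms by (intro antisym limsup_dist_perturb_le)
  then show ?thesis
    by (simp add: asymptotic_center_def)
qed

lemma bounded_range_perturb: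
  fixes x y :: "nat \<Rightarrow> 'a::metric_space"
  assumes "bounded (range x)" and "(\<lambda>n. dist (x n) (y n)) \<longlonglongrightarrow> 0"
  shows "bounded (range y)"
proof -
  obtain a B where B: "\<And>n. dist a (x n) \<le> B"
    using assms(1) by (auto simp: bounded_def)
  obtain C where C: "\<And>n. dist (x n) (y n) \<le> C"
    using convergent_imp_Bseq[OF convergentI[OF assms(2)]] by (auto simp: Bseq_def)
  have "dist a (y n) \<le> B + C" for n
    using dist_triangle[of a "y n" "x n"] B[of n] C[of n] by linarith
  then show ?thesis
    by (auto simp: bounded_def)
qed

lemma Delta_convergent_to_perturb:
  fixes x y :: "nat \<Rightarrow> 'a::metric_space"
  assumes "Delta_convergent_to x z" and "(\<lambda>n. dist (x n) (y n)) \<longlonglongrightarrow> 0"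
  shows "Delta_convergent_to y z"
proof -
  have "asymptotic_center (y \<circ> r) = asymptotic_center (x \<circ> r)" if "strict_mono r" for r
    using LIMSEQ_subseq_LIMSEQ[OF assms(2) that]
    by (intro asymptotic_center_perturb) (simp add: o_def)
  then show ?thesis
    using assms bounded_range_perturb[of x y] by (simp add: Delta_convergent_to_def)
qed

lemma quasi_nonexpansiveD:
  "quasi_nonexpansive S \<Longrightarrow> q \<in> Fix S \<Longrightarrow> dist (S x) q \<le> dist x q"
  by (simp add: quasi_nonexpansive_def)

lemma strongly_quasi_nonexpansiveD:
  assumes "strongly_quasi_nonexpansive S" and "bounded (range x)" and "q \<in> Fix S"
    and "(\<lambda>n. dist (x n) q - dist (S (x n)) q) \<longlonglongrightarrow> 0"
  shows "(\<lambda>n. dist (x n) (S (x n))) \<longlonglongrightarrow> 0"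
  using assms by (auto simp: strongly_quasi_nonexpansive_def)

text \<open>
  Both partial losses of distance to \<open>q\<close> are nonnegative and their sum is the total loss, so each
  of them is squeezed to zero.
\<close>

lemma asymptotic_steps_compose:
  fixes S T :: "'a::metric_space \<Rightarrow> 'a"
  assumes S: "strongly_quasi_nonexpansive S" and T: "strongly_quasi_nonexpansive T"
    and q: "q \<in> Fix S" "q \<in> Fix T"
    and x: "bounded (range x)"
    and loss: "(\<lambda>n. dist (x n) q - dist (T (S (x n))) q) \<longlonglongrightarrow> 0"
  shows "(\<lambda>n. dist (x n) (S (x n))) \<longlonglongrightarrow> 0"
    and "(\<lambda>n. dist (S (x n)) (T (S (x n)))) \<longlonglongrightarrow> 0"
proof -
  have S_le: "dist (S u) q \<le> dist u q" and T_le: "dist (T u) q \<le> dist u q" for u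
    using S T q by (auto simp: strongly_quasi_nonexpansive_def intro: quasi_nonexpansiveD)
  have "(\<lambda>n. dist (x n) q - dist (S (x n)) q) \<longlonglongrightarrow> 0"
    by (rule tendsto_sandwich[OF _ _ tendsto_const loss]) (simp_all add: S_le T_le)
  then show S0: "(\<lambda>n. dist (x n) (S (x n))) \<longlonglongrightarrow> 0"
    by (rule strongly_quasi_nonexpansiveD[OF S x q(1)])
  have "(\<lambda>n. dist (S (x n)) q - dist (T (S (x n))) q) \<longlonglongrightarrow> 0"
    by (rule tendsto_sandwich[OF _ _ tendsto_const loss]) (simp_all add: S_le T_le)
  then show "(\<lambda>n. dist (S (x n)) (T (S (x n)))) \<longlonglongrightarrow> 0"
    by (rule strongly_quasi_nonexpansiveD[OF T bounded_range_perturb[OF x S0] q(2)])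
qed

text \<open>
  A fixed point \<open>u\<close> of the composition loses no distance to a common fixed point, so the
  constant sequence at \<open>u\<close> forces \<open>S u = u\<close> and \<open>T (S u) = S u\<close>.
\<close>

lemma Fix_compose:
  fixes S T :: "'a::metric_space \<Rightarrow> 'a"
  assumes "strongly_quasi_nonexpansive S" and "strongly_quasi_nonexpansive T"
    and "Fix S \<inter> Fix T \<noteq> {}"
  shows "Fix (T \<circ> S) = Fix S \<inter> Fix T"
proof
  show "Fix (T \<circ> S) \<subseteq> Fix S \<inter> Fix T"
  proof
    fix u assume "u \<in> Fix (T \<circ> S)"
    then have u: "T (S u) = u"
      by (simp add: Fix_def)
    obtain p where "p \<in> Fix S" "p \<in> Fix T"
      using assms(3) by blast
    then have "(\<lambda>n::nat. dist u (S u)) \<longlonglongrightarrow> 0"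
      using u by (intro asymptotic_steps_compose(1)[OF assms(1,2)]) auto
    then show "u \<in> Fix S \<inter> Fix T"
      using u by (auto simp: Fix_def LIMSEQ_const_iff)
  qed
qed (auto simp: Fix_def)

lemma strongly_quasi_nonexpansive_compose:
  fixes S T :: "'a::metric_space \<Rightarrow> 'a"
  assumes S: "strongly_quasi_nonexpansive S" and T: "strongly_quasi_nonexpansive T"
    and common: "Fix S \<inter> Fix T \<noteq> {}"
  shows "strongly_quasi_nonexpansive (T \<circ> S)"
proof -
  note Fix = Fix_compose[OF assms]
  have "dist (T (S u)) q \<le> dist u q" if "q \<in> Fix S \<inter> Fix T" for u q
    using that S T unfolding strongly_quasi_nonexpansive_def
    by (meson IntD1 IntD2 order_trans quasi_nonexpansiveD)
  then have "quasi_nonexpansive (T \<circ> S)"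
    using common by (simp add: quasi_nonexpansive_def Fix)
  moreover have "(\<lambda>n. dist (x n) (T (S (x n)))) \<longlonglongrightarrow> 0"
    if "bounded (range x)" "q \<in> Fix S" "q \<in> Fix T"
      and "(\<lambda>n. dist (x n) q - dist (T (S (x n))) q) \<longlonglongrightarrow> 0" for x q
  proof (rule tendsto_sandwich[OF _ _ tendsto_const])
    show "(\<lambda>n. dist (x n) (S (x n)) + dist (S (x n)) (T (S (x n)))) \<longlonglongrightarrow> 0"
      using asymptotic_steps_compose[OF S T that(2,3,1,4)] by (rule tendsto_add_zero)
  qed (simp_all add: dist_triangle)
  ultimately show ?thesis
    by (auto simp: strongly_quasi_nonexpansive_def Fix)
qed

lemma Delta_demiclosed_compose:
  fixes S T :: "'a::metric_space \<Rightarrow> 'a"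
  assumes S: "strongly_quasi_nonexpansive S" "Delta_demiclosed S"
    and T: "strongly_quasi_nonexpansive T" "Delta_demiclosed T"
    and common: "Fix S \<inter> Fix T \<noteq> {}"
  shows "Delta_demiclosed (T \<circ> S)"
  unfolding Delta_demiclosed_def
proof (intro allI impI, elim conjE)
  fix x z assume x: "Delta_convergent_to x z"
    and TS0: "(\<lambda>n. dist (x n) ((T \<circ> S) (x n))) \<longlonglongrightarrow> 0"
  obtain p where p: "p \<in> Fix S" "p \<in> Fix T"
    using common by blast
  have bdd: "bounded (range x)"
    using x by (simp add: Delta_convergent_to_def)
  have "\<bar>dist (x n) p - dist (T (S (x n))) p\<bar> \<le> dist (x n) ((T \<circ> S) (x n))" for n
    using abs_dist_diff_le[of "x n" p "T (S (x n))"] by (simp add: dist_commute)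
  then have loss: "(\<lambda>n. dist (x n) p - dist (T (S (x n))) p) \<longlonglongrightarrow> 0"
    by (intro Lim_null_comparison[OF _ TS0]) simp
  note steps = asymptotic_steps_compose[OF S(1) T(1) p bdd loss]
  have "z \<in> Fix S"
    using S(2) x steps(1) by (auto simp: Delta_demiclosed_def)
  moreover have "Delta_convergent_to (\<lambda>n. S (x n)) z"
    using x steps(1) by (rule Delta_convergent_to_perturb)
  then have "z \<in> Fix T"
    using T(2) steps(2) unfolding Delta_demiclosed_def by blast
  ultimately show "z \<in> Fix (T \<circ> S)"
    by (simp add: Fix_def)
qed

text \<open>
  The claim \<open>Fix (composition_upto S m) = (\<Inter>i\<in>{1..m}. Fix (S i))\<close> is carried along because it
  supplies, at the next step, a common fixed point of the partial composition and the new factor.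
\<close>

lemma composition_upto_properties:
  fixes S :: "nat \<Rightarrow> 'a::metric_space \<Rightarrow> 'a"
  assumes "\<And>i. i \<in> {1..m} \<Longrightarrow> strongly_quasi_nonexpansive (S i)"
    and "\<And>i. i \<in> {1..m} \<Longrightarrow> Delta_demiclosed (S i)"
    and "(\<Inter>i\<in>{1..m}. Fix (S i)) \<noteq> {}"
  shows "strongly_quasi_nonexpansive (composition_upto S m) \<and>
         Delta_demiclosed (composition_upto S m) \<and>
         Fix (composition_upto S m) = (\<Inter>i\<in>{1..m}. Fix (S i))"
  using assms
proof (induction m)
  case 0
  show ?case
    by (simp add: strongly_quasi_nonexpansive_def quasi_nonexpansive_def Delta_demiclosed_def
        Fix_def)
next
  case (Suc m)
  let ?C = "composition_upto S m"
  have Inter: "(\<Inter>i\<in>{1..Suc m}. Fix (S i)) = (\<Inter>i\<in>{1..m}. Fix (S i)) \<inter> Fix (S (Suc m))"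
    by (simp add: atLeastAtMostSuc_conv Int_commute)
  have C: "strongly_quasi_nonexpansive ?C" "Delta_demiclosed ?C"
    "Fix ?C = (\<Inter>i\<in>{1..m}. Fix (S i))"
    using Suc Inter by auto
  have T: "strongly_quasi_nonexpansive (S (Suc m))" "Delta_demiclosed (S (Suc m))"
    using Suc.prems by simp_all
  have common: "Fix ?C \<inter> Fix (S (Suc m)) \<noteq> {}"
    using Suc.prems(3) by (simp only: Inter C(3) not_False_eq_True)
  show ?case
    using strongly_quasi_nonexpansive_compose[OF C(1) T(1) common]
      Delta_demiclosed_compose[OF C(1,2) T common] Fix_compose[OF C(1) T(1) common]
    by (simp only: composition_upto.simps Inter C(3) simp_thms)
qed

lemma Delta_demiclosed_imp_orbital:
  "Delta_demiclosed S \<Longrightarrow> orbital_Delta_demiclosed S"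
  by (auto simp: Delta_demiclosed_def orbital_Delta_demiclosed_def dist_commute)

theorem proposition1:
  fixes S :: "nat \<Rightarrow> 'a::hadamard_space \<Rightarrow> 'a" and m :: nat
  assumes "m \<ge> 1"
    and "\<And>i. i \<in> {1..m} \<Longrightarrow> strongly_quasi_nonexpansive (S i)"
    and "\<And>i. i \<in> {1..m} \<Longrightarrow> Delta_demiclosed (S i)"
    and "(\<Inter>i\<in>{1..m}. Fix (S i)) \<noteq> {}"
  shows "strongly_quasi_nonexpansive (composition_upto S m) \<and>
         orbital_Delta_demiclosed (composition_upto S m)"
  using composition_upto_properties[OF assms(2-4)] Delta_demiclosed_imp_orbital by blast

end
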